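(* Let $n\geq m\geq 2$ and $m\geq k\geq 1$ be integers. If $A$ is a complex $m\times n$ matrix, then $$\|A\|_{F_k}\leq \sqrt{k}\,|A|_2.$$ Equality holds if and only if $A$ has exactly $k$ nonzero singular values and they are equal.
   Context: For a complex $m\times n$ matrix $A=[a_{ij}]$ with $m\le n$, $\sigma_1(A)\geq\cdots\geq\sigma_m(A)$ denote its singular values, i.e. the square roots of the eigenvalues of $AA^*$ (where $A^*$ is the Hermitian adjoint of $A$), listed with multiplicity; $\|A\|_{F_k}=\sigma_1(A)+\cdots+\sigma_k(A)$ is the Ky Fan $k$-norm; and $|A|_2=\left(\sum_{i,j}|a_{ij}|^2\right)^{1/2}$.
   Formalization: The equality criterion is stated only for A nonzero: for A = 0 both sides equal 0, so equality holds although A has no nonzero singular value while k is at least 1; the inequality is stated for all A. *)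

theory Defs
  imports
    "Jordan_Normal_Form.Schur_Decomposition"
    "HOL-Computational_Algebra.Fundamental_Theorem_Algebra"
begin

(* The eigenvalues of A A* are counted with algebraic multiplicity, as roots of the
   characteristic polynomial; see proots_char_poly_gram_real below for why taking Re
   loses nothing. The list is in decreasing order. *)
definition singular_values :: "complex mat \<Rightarrow> real list" where
  "singular_values A =
     rev (sorted_list_of_multiset
       (image_mset (\<lambda>z. sqrt (Re z)) (proots (char_poly (A * mat_adjoint A)))))"

(* Indexed from 1; only meaningful for 1 \<le> i \<le> dim_row A. *)
definition singular_value :: "nat \<Rightarrow> complex mat \<Rightarrow> real" where
  "singular_value i A = singular_values A ! (i - 1)"

definition ky_fan_norm :: "nat \<Rightarrow> complex mat \<Rightarrow> real" where
  "ky_fan_norm k A = (\<Sum>i=1..k. singular_value i A)"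

definition entrywise_norm2 :: "complex mat \<Rightarrow> real" where
  "entrywise_norm2 A = sqrt (\<Sum>i<dim_row A. \<Sum>j<dim_col A. (cmod (A $$ (i, j)))\<^sup>2)"

lemma mat_adjoint_carrier:
  "A \<in> carrier_mat m n \<Longrightarrow> mat_adjoint A \<in> carrier_mat n m"
  unfolding mat_adjoint_def by (auto simp: mat_of_rows_def)

lemma mat_adjoint_index:
  "i < dim_col A \<Longrightarrow> j < dim_row A \<Longrightarrow> mat_adjoint A $$ (i, j) = cnj (A $$ (j, i))"
  unfolding mat_adjoint_def by (simp add: mat_of_rows_def)

lemma length_singular_values:
  assumes "A \<in> carrier_mat m n"
  shows "length (singular_values A) = m"
proof -
  have c: "A * mat_adjoint A \<in> carrier_mat m m"
    using assms mat_adjoint_carrier[OF assms] by auto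
  show ?thesis
    using degree_monic_char_poly[OF c]
    unfolding singular_values_def
    by (metis length_rev mset_sorted_list_of_multiset size_image_mset size_mset size_proots_complex)
qed

lemma proots_char_poly_gram_real:
  assumes A: "A \<in> carrier_mat m n"
    and z: "z \<in># proots (char_poly (A * mat_adjoint A))"
  shows "z \<in> \<real>" and "Re z \<ge> 0"
proof -
  let ?B = "mat_adjoint A"
  have B: "?B \<in> carrier_mat n m" using mat_adjoint_carrier[OF A] .
  have c: "A * ?B \<in> carrier_mat m m" using A B by auto
  have nz: "char_poly (A * ?B) \<noteq> 0" using degree_monic_char_poly[OF c] by auto
  have "eigenvalue (A * ?B) z"
    using z nz eigenvalue_root_char_poly[OF c] by simp
  then obtain v where v: "v \<in> carrier_vec m" "v \<noteq> 0\<^sub>v m" "(A * ?B) *\<^sub>v v = z \<cdot>\<^sub>v v"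
    using c unfolding eigenvalue_def eigenvector_def by auto
  define w where "w = ?B *\<^sub>v v"
  have w: "w \<in> carrier_vec n" using B v unfolding w_def by auto
  have Aw: "A *\<^sub>v w = z \<cdot>\<^sub>v v" using v A B unfolding w_def by simp
  have wi: "w $ j = (\<Sum>i<m. cnj (A $$ (i, j)) * v $ i)" if "j < n" for j
    using that A B v(1) unfolding w_def
    by (auto simp: scalar_prod_def mat_adjoint_index lessThan_atLeast0 intro!: sum.cong)
  have Ai: "z * v $ i = (\<Sum>j<n. A $$ (i, j) * w $ j)" if "i < m" for i
  proof -
    have "z * v $ i = (A *\<^sub>v w) $ i" using Aw v(1) that by simp
    also have "\<dots> = (\<Sum>j<n. A $$ (i, j) * w $ j)"
      using that A w by (auto simp: scalar_prod_def lessThan_atLeast0 intro!: sum.cong)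
    finally show ?thesis .
  qed
  define a b where "a = (\<Sum>i<m. (cmod (v $ i))\<^sup>2)" and "b = (\<Sum>j<n. (cmod (w $ j))\<^sup>2)"
  have "z * of_real a = (\<Sum>i<m. (z * v $ i) * cnj (v $ i))"
    unfolding a_def by (simp add: sum_distrib_left mult.assoc flip: complex_norm_square)
  also have "\<dots> = (\<Sum>i<m. \<Sum>j<n. A $$ (i, j) * w $ j * cnj (v $ i))"
    by (intro sum.cong refl) (simp add: Ai sum_distrib_right)
  also have "\<dots> = (\<Sum>j<n. \<Sum>i<m. A $$ (i, j) * w $ j * cnj (v $ i))"
    by (rule sum.swap)
  also have "\<dots> = (\<Sum>j<n. w $ j * cnj (w $ j))"
  proof (intro sum.cong refl)
    fix j assume "j \<in> {..<n}"
    then have "cnj (w $ j) = (\<Sum>i<m. A $$ (i, j) * cnj (v $ i))" by (simp add: wi)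
    then show "(\<Sum>i<m. A $$ (i, j) * w $ j * cnj (v $ i)) = w $ j * cnj (w $ j)"
      by (simp add: sum_distrib_left ac_simps)
  qed
  also have "\<dots> = of_real b" unfolding b_def by (simp flip: complex_norm_square)
  finally have eq: "z * of_real a = of_real b" .
  obtain i where i: "i < m" "v $ i \<noteq> 0" using v(1,2) by (metis carrier_vecD eq_vecI index_zero_vec(1,2))
  have "a \<ge> (cmod (v $ i))\<^sup>2" unfolding a_def using i(1) by (intro member_le_sum) auto
  then have "a > 0" using i(2) by (smt (verit) zero_less_norm_iff zero_less_power)
  moreover have "b \<ge> 0" unfolding b_def by (simp add: sum_nonneg)
  ultimately have "z = of_real (b / a)" "b / a \<ge> 0"
    using eq by (auto simp: field_simps)
  then show "z \<in> \<real>" "Re z \<ge> 0" by auto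
qed

end

theory Submission
  imports Defs
begin

text \<open>The squares of the singular values sum to the trace of \<open>A A\<^sup>*\<close>, which is \<open>|A|\<^sub>2\<^sup>2\<close>. Writing \<open>\<mu>\<close>
  for the mean of the first \<open>k\<close> singular values, one has
  \<open>|A|\<^sub>2\<^sup>2 - k \<mu>\<^sup>2 = (\<Sum>i\<le>k. (\<sigma>\<^sub>i - \<mu>)\<^sup>2) + (\<Sum>i>k. \<sigma>\<^sub>i\<^sup>2)\<close>, which gives both the inequality and its equality
  case.\<close>

text \<open>Both traces are the double sum of \<open>A $$ (i, j) * B $$ (j, i)\<close>, taken in
  either order; the factors may be rectangular.\<close>

lemma sum_diag_mult_commute:
  fixes A B :: "'a :: comm_semiring_0 mat"
  assumes "A \<in> carrier_mat m n" and "B \<in> carrier_mat n m"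
  shows "(\<Sum>i<m. (A * B) $$ (i, i)) = (\<Sum>j<n. (B * A) $$ (j, j))"
proof -
  have "(\<Sum>i<m. (A * B) $$ (i, i)) = (\<Sum>i<m. \<Sum>j<n. A $$ (i, j) * B $$ (j, i))"
    using assms by (intro sum.cong refl) (auto simp: scalar_prod_def lessThan_atLeast0)
  also have "\<dots> = (\<Sum>j<n. \<Sum>i<m. B $$ (j, i) * A $$ (i, j))"
    by (subst sum.swap) (simp add: mult.commute)
  also have "\<dots> = (\<Sum>j<n. (B * A) $$ (j, j))"
    using assms by (intro sum.cong refl) (auto simp: scalar_prod_def lessThan_atLeast0)
  finally show ?thesis .
qed

text \<open>Write \<open>A\<close> as \<open>P * B * Q\<close>, move \<open>P\<close> cyclically to
  the end of the trace, and cancel \<open>Q * P\<close>.\<close>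

lemma sum_diag_similar_mat_wit:
  fixes A :: "'a :: comm_ring_1 mat"
  assumes "A \<in> carrier_mat n n" and "similar_mat_wit A B P Q"
  shows "(\<Sum>i<n. A $$ (i, i)) = (\<Sum>i<n. B $$ (i, i))"
proof -
  note w = similar_mat_witD2[OF assms]
  have "(\<Sum>i<n. A $$ (i, i)) = (\<Sum>i<n. (P * (B * Q)) $$ (i, i))"
    using w by (simp add: assoc_mult_mat[of P n n B n Q n])
  also have "\<dots> = (\<Sum>i<n. (B * Q * P) $$ (i, i))"
    by (rule sum_diag_mult_commute) (use w in auto)
  also have "B * Q * P = B"
    using w by (simp add: assoc_mult_mat[of B n n Q n P n])
  finally show ?thesis .
qed

text \<open>Schur triangularisation puts the eigenvalues, with algebraic multiplicity, on the
  diagonal of a matrix similar to \<open>A\<close>, and similarity preserves the trace.\<close>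

lemma sum_proots_char_poly:
  fixes A :: "complex mat"
  assumes A: "A \<in> carrier_mat n n"
  shows "(\<Sum>z\<in>#proots (char_poly A). z) = (\<Sum>i<n. A $$ (i, i))"
proof -
  \<comment> \<open>Any ordering of the roots will do: the Schur decomposition takes the eigenvalues
    as a list and reproduces it on the diagonal.\<close>
  obtain es where es: "mset es = proots (char_poly A)"
    using ex_mset by blast
  have "char_poly A = (\<Prod>z\<in>#proots (char_poly A). [:- z, 1:])"
    using complex_poly_decompose_multiset[of "char_poly A"] degree_monic_char_poly[OF A] by simp
  also have "\<dots> = (\<Prod>e\<leftarrow>es. [:- e, 1:])"
    by (simp flip: es prod_mset_prod_list)
  finally have cp: "char_poly A = (\<Prod>e\<leftarrow>es. [:- e, 1:])" .
  obtain B P Q where BPQ: "schur_decomposition A es = (B, P, Q)"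
    by (cases "schur_decomposition A es")
  from schur_decomposition[OF A cp BPQ]
  have sim: "similar_mat_wit A B P Q" and diag: "diag_mat B = es" by auto
  have B: "B \<in> carrier_mat n n" using similar_mat_witD2[OF A sim] by simp
  have "(\<Sum>z\<in>#proots (char_poly A). z) = sum_list (diag_mat B)"
    by (simp add: diag sum_mset_sum_list flip: es)
  also have "\<dots> = (\<Sum>i<n. B $$ (i, i))"
    using B by (simp add: diag_mat_def interv_sum_list_conv_sum_set_nat lessThan_atLeast0)
  also have "\<dots> = (\<Sum>i<n. A $$ (i, i))"
    using sum_diag_similar_mat_wit[OF A sim] by simp
  finally show ?thesis .
qed

text \<open>The \<open>i\<close>-th diagonal entry of the Gram matrix is the squared Euclidean norm
  of row \<open>i\<close>.\<close>

lemma sum_diag_gram: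
  assumes A: "A \<in> carrier_mat m n"
  shows "(\<Sum>i<m. (A * mat_adjoint A) $$ (i, i)) = of_real ((entrywise_norm2 A)\<^sup>2)"
proof -
  have "(A * mat_adjoint A) $$ (i, i) = (\<Sum>j<n. of_real ((cmod (A $$ (i, j)))\<^sup>2))" if "i < m" for i
    using A mat_adjoint_carrier[OF A] that
    by (auto simp: scalar_prod_def mat_adjoint_index lessThan_atLeast0 complex_norm_square
        simp flip: of_real_power intro!: sum.cong)
  then show ?thesis
    using A by (simp add: entrywise_norm2_def sum_nonneg)
qed

lemma singular_value_nonneg:
  assumes A: "A \<in> carrier_mat m n" and i: "i \<in> {1..m}"
  shows "singular_value i A \<ge> 0"
proof -
  have "singular_value i A \<in> set (singular_values A)"
    using i length_singular_values[OF A] by (auto simp: singular_value_def)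
  then show ?thesis
    using proots_char_poly_gram_real(2)[OF A]
    by (auto simp: singular_values_def simp flip: set_mset_mset)
qed

lemma singular_value_antimono:
  assumes A: "A \<in> carrier_mat m n" and "1 \<le> i" "i \<le> j" "j \<le> m"
  shows "singular_value j A \<le> singular_value i A"
  unfolding singular_value_def singular_values_def
  by (rule sorted_rev_nth_mono)
    (use assms length_singular_values[OF A] in \<open>auto simp: singular_values_def\<close>)

lemma sum_singular_value_squared:
  assumes A: "A \<in> carrier_mat m n"
  shows "(\<Sum>i=1..m. (singular_value i A)\<^sup>2) = (entrywise_norm2 A)\<^sup>2"
proof -
  let ?M = "proots (char_poly (A * mat_adjoint A))"
  have c: "A * mat_adjoint A \<in> carrier_mat m m"
    using A mat_adjoint_carrier[OF A] by auto
  \<comment> \<open>Singular values are numbered from 1, list positions from 0.\<close>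
  have "(\<Sum>i=1..m. (singular_value i A)\<^sup>2) = (\<Sum>i<m. (singular_values A ! i)\<^sup>2)"
    unfolding singular_value_def
    by (rule sum.reindex_bij_witness[of _ Suc "\<lambda>i. i - 1"]) auto
  also have "\<dots> = (\<Sum>x\<leftarrow>singular_values A. x\<^sup>2)"
    using length_singular_values[OF A] by (simp add: sum_list_sum_nth lessThan_atLeast0)
  also have "\<dots> = (\<Sum>x\<in>#mset (singular_values A). x\<^sup>2)"
    by (metis mset_map sum_mset_sum_list)
  also have "\<dots> = (\<Sum>z\<in>#?M. (sqrt (Re z))\<^sup>2)"
    by (simp add: singular_values_def image_mset.compositionality o_def)
  \<comment> \<open>Squaring undoes the root because the eigenvalues of the Gram matrix have
    nonnegative real part.\<close>
  also have "\<dots> = (\<Sum>z\<in>#?M. Re z)"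
    by (intro arg_cong[where f = sum_mset] image_mset_cong)
      (simp add: proots_char_poly_gram_real(2)[OF A])
  also have "\<dots> = Re (\<Sum>z\<in>#?M. z)"
    by (induction rule: multiset_induct[of _ ?M]) auto
  also have "\<dots> = (entrywise_norm2 A)\<^sup>2"
    using sum_proots_char_poly[OF c] sum_diag_gram[OF A] by simp
  finally show ?thesis .
qed

lemma entrywise_norm2_nonneg: "entrywise_norm2 A \<ge> 0"
  by (simp add: entrywise_norm2_def sum_nonneg)

lemma entrywise_norm2_eq_0_imp:
  assumes A: "A \<in> carrier_mat m n" and "entrywise_norm2 A = 0"
  shows "A = 0\<^sub>m m n"
proof -
  have "A $$ (i, j) = 0" if "i < m" "j < n" for i j
    using assms that by (auto simp: entrywise_norm2_def sum_nonneg sum_nonneg_eq_0_iff)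
  then show ?thesis using A by auto
qed

text \<open>The first \<open>k\<close> terms sum to \<open>real k * \<mu>\<close>, so in the
  expanded squares the cross term and the constant term combine to
  \<open>- real k * \<mu>\<^sup>2\<close>.\<close>

lemma sum_squares_minus_mean:
  fixes s :: "nat \<Rightarrow> real"
  assumes "1 \<le> k" "k \<le> m"
  defines "\<mu> \<equiv> (\<Sum>i=1..k. s i) / real k"
  shows "(\<Sum>i=1..m. (s i)\<^sup>2) - real k * \<mu>\<^sup>2 = (\<Sum>i=1..k. (s i - \<mu>)\<^sup>2) + (\<Sum>i=Suc k..m. (s i)\<^sup>2)"
proof -
  have S: "(\<Sum>i=1..k. s i) = real k * \<mu>" using assms by simp
  have "(\<Sum>i=1..k. (s i - \<mu>)\<^sup>2) = (\<Sum>i=1..k. (s i)\<^sup>2) - 2 * \<mu> * (\<Sum>i=1..k. s i) + real k * \<mu>\<^sup>2"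
    by (simp add: power2_diff sum.distrib sum_subtractf sum_distrib_left mult_ac)
  moreover have "(\<Sum>i=1..m. (s i)\<^sup>2) = (\<Sum>i=1..k. (s i)\<^sup>2) + (\<Sum>i=Suc k..m. (s i)\<^sup>2)"
    using sum.ub_add_nat[of 1 k "\<lambda>i. (s i)\<^sup>2" "m - k"] assms by simp
  ultimately show ?thesis unfolding S by (simp add: power2_eq_square)
qed

lemma sum_le_sqrt_sum_squares:
  fixes s :: "nat \<Rightarrow> real"
  assumes k: "1 \<le> k" "k \<le> m"
  shows "(\<Sum>i=1..k. s i) \<le> sqrt (real k) * sqrt (\<Sum>i=1..m. (s i)\<^sup>2)"
proof -
  define \<mu> where "\<mu> = (\<Sum>i=1..k. s i) / real k"
  have S: "(\<Sum>i=1..k. s i) = real k * \<mu>" using k by (simp add: \<mu>_def)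
  have "0 \<le> (\<Sum>i=1..m. (s i)\<^sup>2) - real k * \<mu>\<^sup>2"
    unfolding \<mu>_def sum_squares_minus_mean[OF k] by (intro add_nonneg_nonneg sum_nonneg) auto
  \<comment> \<open>The extra factor \<open>real k\<close> turns the left side into the square of
    the partial sum, ready for taking roots.\<close>
  then have "real k * (real k * \<mu>\<^sup>2) \<le> real k * (\<Sum>i=1..m. (s i)\<^sup>2)"
    by (intro mult_left_mono) auto
  then show ?thesis
    unfolding S real_sqrt_mult[symmetric]
    by (intro real_le_rsqrt) (simp add: power2_eq_square mult_ac)
qed

text \<open>Equality makes both sums of squares in \<open>sum_squares_minus_mean\<close> vanish,
  hence each of their terms.\<close>

lemma sum_eq_sqrt_sum_squares_imp:
  fixes s :: "nat \<Rightarrow> real"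
  assumes k: "1 \<le> k" "k \<le> m"
    and eq: "(\<Sum>i=1..k. s i) = sqrt (real k) * sqrt (\<Sum>i=1..m. (s i)\<^sup>2)"
  shows "\<exists>\<mu>. (\<forall>i\<in>{1..k}. s i = \<mu>) \<and> (\<forall>i\<in>{Suc k..m}. s i = 0)"
proof -
  define \<mu> where "\<mu> = (\<Sum>i=1..k. s i) / real k"
  have S: "(\<Sum>i=1..k. s i) = real k * \<mu>" using k by (simp add: \<mu>_def)
  have "(real k * \<mu>)\<^sup>2 = real k * (\<Sum>i=1..m. (s i)\<^sup>2)"
    unfolding S[symmetric] eq by (simp add: power_mult_distrib sum_nonneg)
  then have "(\<Sum>i=1..m. (s i)\<^sup>2) - real k * \<mu>\<^sup>2 = 0"
    using k by (simp add: power2_eq_square algebra_simps)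
  then have "(\<Sum>i=1..k. (s i - \<mu>)\<^sup>2) + (\<Sum>i=Suc k..m. (s i)\<^sup>2) = 0"
    unfolding \<mu>_def sum_squares_minus_mean[OF k] .
  then have "(\<Sum>i=1..k. (s i - \<mu>)\<^sup>2) = 0 \<and> (\<Sum>i=Suc k..m. (s i)\<^sup>2) = 0"
    by (subst (asm) add_nonneg_eq_0_iff) (auto intro: sum_nonneg)
  then show ?thesis by (auto simp: sum_nonneg_eq_0_iff)
qed

text \<open>Every term up to the last nonzero one is at least as large as that one, hence positive.
  This turns a count of nonzero singular values into their positions.\<close>

lemma antimono_support_eq_initial_segment:
  fixes s :: "nat \<Rightarrow> real"
  assumes nonneg: "\<And>i. i \<in> {1..m} \<Longrightarrow> s i \<ge> 0"
    and anti: "\<And>i j. 1 \<le> i \<Longrightarrow> i \<le> j \<Longrightarrow> j \<le> m \<Longrightarrow> s j \<le> s i"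
  shows "{i \<in> {1..m}. s i \<noteq> 0} = {1..card {i \<in> {1..m}. s i \<noteq> 0}}"
proof (cases "{i \<in> {1..m}. s i \<noteq> 0} = {}")
  case False
  define N where "N = {i \<in> {1..m}. s i \<noteq> 0}"
  define M where "M = Max N"
  have fin: "finite N" by (simp add: N_def)
  have M: "M \<in> N" unfolding M_def by (rule Max_in) (use False in \<open>auto simp: N_def\<close>)
  have "N = {1..M}"
  proof (intro equalityI subsetI)
    fix i assume "i \<in> N"
    then show "i \<in> {1..M}" using fin by (auto simp: M_def N_def)
  next
    fix i assume i: "i \<in> {1..M}"
    then have "s M \<le> s i" using anti[of i M] M by (simp add: N_def)
    moreover have "s M > 0" using nonneg[of M] M by (simp add: N_def less_le)
    ultimately show "i \<in> N" using i M by (simp add: N_def)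
  qed
  then have "N = {1..card N}" by (metis card_atLeastAtMost diff_Suc_1)
  then show ?thesis by (simp only: N_def)
qed simp

text \<open>For the zero matrix both sides of the inequality are 0 while no singular value is
  nonzero, and \<open>k \<ge> 1\<close>; hence the equality case is stated for nonzero
  \<open>A\<close>.\<close>

theorem theorem11:
  fixes A :: "complex mat" and m n k :: nat
  assumes "n \<ge> m" and "m \<ge> 2" and "m \<ge> k" and "k \<ge> 1"
    and "A \<in> carrier_mat m n"
  shows "ky_fan_norm k A \<le> sqrt (real k) * entrywise_norm2 A \<and>
    (A \<noteq> 0\<^sub>m m n \<longrightarrow>
      (ky_fan_norm k A = sqrt (real k) * entrywise_norm2 A \<longleftrightarrow>
        card {i \<in> {1..m}. singular_value i A \<noteq> 0} = k \<and>
        (\<forall>i \<in> {1..m}. \<forall>j \<in> {1..m}.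
           singular_value i A \<noteq> 0 \<longrightarrow> singular_value j A \<noteq> 0 \<longrightarrow>
           singular_value i A = singular_value j A)))"
proof -
  note A = \<open>A \<in> carrier_mat m n\<close> and k = \<open>1 \<le> k\<close> \<open>k \<le> m\<close>
  define s where "s i = singular_value i A" for i
  let ?N = "{i \<in> {1..m}. s i \<noteq> 0}"
  have norm: "entrywise_norm2 A = sqrt (\<Sum>i=1..m. (s i)\<^sup>2)"
    using sum_singular_value_squared[OF A] by (simp add: s_def entrywise_norm2_nonneg)
  have le: "(\<Sum>i=1..k. s i) \<le> sqrt (real k) * entrywise_norm2 A"
    unfolding norm using k by (rule sum_le_sqrt_sum_squares)
  have eq_iff: "(\<Sum>i=1..k. s i) = sqrt (real k) * entrywise_norm2 A \<longleftrightarrow>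
      card ?N = k \<and> (\<forall>i\<in>{1..m}. \<forall>j\<in>{1..m}. s i \<noteq> 0 \<longrightarrow> s j \<noteq> 0 \<longrightarrow> s i = s j)"
    (is "?eq \<longleftrightarrow> ?flat") if nz: "A \<noteq> 0\<^sub>m m n"
  proof
    assume ?eq
    from sum_eq_sqrt_sum_squares_imp[OF k this[unfolded norm]] obtain \<mu>
      where \<mu>: "\<And>i. i \<in> {1..k} \<Longrightarrow> s i = \<mu>" and z: "\<And>i. i \<in> {Suc k..m} \<Longrightarrow> s i = 0" by blast
    \<comment> \<open>If the common value were 0, all singular values would vanish and
      \<open>A\<close> would be zero. So exactly the first \<open>k\<close> are nonzero.\<close>
    have "\<mu> \<noteq> 0"
    proof
      assume "\<mu> = 0"
      then have "(\<Sum>i=1..m. (s i)\<^sup>2) = 0"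
        using \<mu> z by (intro sum.neutral) (metis atLeastAtMost_iff not_less_eq_eq zero_power2)
      then show False using nz entrywise_norm2_eq_0_imp[OF A] norm by simp
    qed
    then have N: "?N = {1..k}"
      using \<mu> z k by (auto simp: not_less_eq_eq) (metis not_less_eq_eq)
    have eq: "s i = \<mu>" if "i \<in> {1..m}" "s i \<noteq> 0" for i
      using N \<mu> that by blast
    have "card ?N = k" by (simp only: N card_atLeastAtMost diff_Suc_1)
    with eq show ?flat by metis
  next
    assume flat: ?flat
    \<comment> \<open>The hypothesis only counts the nonzero singular values; their decreasing order
      places them at the indices summed in the Ky Fan norm.\<close>
    have "?N = {1..card ?N}"
      by (rule antimono_support_eq_initial_segment)
        (auto simp: s_def intro: singular_value_nonneg[OF A] singular_value_antimono[OF A])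
    then have N: "?N = {1..k}" using flat by simp
    define c where "c = s 1"
    have c: "s i = c" if "i \<in> {1..k}" for i
    proof -
      have "i \<in> ?N" "1 \<in> ?N" unfolding N using that k by auto
      then show ?thesis using flat unfolding c_def by blast
    qed
    \<comment> \<open>The sign is what lets \<open>sqrt (c\<^sup>2)\<close> simplify to
      \<open>c\<close> at the end.\<close>
    have "c \<ge> 0" using singular_value_nonneg[OF A, of 1] k by (simp add: c_def s_def)
    have z: "s i = 0" if "i \<in> {1..m} - {1..k}" for i
      using N that by blast
    have "(\<Sum>i=1..m. (s i)\<^sup>2) = (\<Sum>i=1..k. (s i)\<^sup>2)"
      by (rule sum.mono_neutral_right) (use k z in auto)
    also have "\<dots> = real k * c\<^sup>2" using c by simp
    finally show ?eq
      using \<open>c \<ge> 0\<close> by (simp add: norm c real_sqrt_mult)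
  qed
  show ?thesis
    using le eq_iff unfolding ky_fan_norm_def s_def by blast
qed

end
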